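(* Let $A$ be an algebra over a field $F$ of characteristic $0$, and let $T$ be a homomorphic averaging operator on $A$. Then $R=-T$ is a Rota--Baxter operator of weight $1$ on $A$.
   Context: A linear operator $R$ on an algebra $A$ over $F$ is a Rota--Baxter operator of weight $\lambda\in F$ if $R(a)R(b)=R\big(R(a)b+aR(b)+\lambda ab\big)$ for all $a,b\in A$. A linear operator $T$ on $A$ is an averaging operator if $T(a)T(b)=T(T(a)b)=T(aT(b))$ for all $a,b\in A$; it is a homomorphic averaging operator if in addition $T(ab)=T(a)T(b)$ for all $a,b\in A$. *)

theory Defs
  imports Complex_Main
begin

text \<open>Algebras over a field are neither assumed to be associative, nor commutative, nor unital:
  an algebra is a vector space with a bilinear multiplication.\<close>

locale field_algebra = vector_space scale
  for scale :: "'f::field \<Rightarrow> 'a::ab_group_add \<Rightarrow> 'a" +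
  fixes mult :: "'a \<Rightarrow> 'a \<Rightarrow> 'a"
  assumes linear_mult_left: "Vector_Spaces.linear scale scale (\<lambda>a. mult a b)"
    and linear_mult_right: "Vector_Spaces.linear scale scale (\<lambda>b. mult a b)"

definition rota_baxter_operator ::
    "('f::field \<Rightarrow> 'a::ab_group_add \<Rightarrow> 'a) \<Rightarrow> ('a \<Rightarrow> 'a \<Rightarrow> 'a) \<Rightarrow> 'f \<Rightarrow> ('a \<Rightarrow> 'a) \<Rightarrow> bool"
  where "rota_baxter_operator scale mult w R \<longleftrightarrow>
    Vector_Spaces.linear scale scale R \<and>
    (\<forall>a b. mult (R a) (R b) = R (mult (R a) b + mult a (R b) + scale w (mult a b)))"

definition averaging_operator ::
    "('f::field \<Rightarrow> 'a::ab_group_add \<Rightarrow> 'a) \<Rightarrow> ('a \<Rightarrow> 'a \<Rightarrow> 'a) \<Rightarrow> ('a \<Rightarrow> 'a) \<Rightarrow> bool"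
  where "averaging_operator scale mult T \<longleftrightarrow>
    Vector_Spaces.linear scale scale T \<and>
    (\<forall>a b. mult (T a) (T b) = T (mult (T a) b) \<and> T (mult (T a) b) = T (mult a (T b)))"

definition homomorphic_averaging_operator ::
    "('f::field \<Rightarrow> 'a::ab_group_add \<Rightarrow> 'a) \<Rightarrow> ('a \<Rightarrow> 'a \<Rightarrow> 'a) \<Rightarrow> ('a \<Rightarrow> 'a) \<Rightarrow> bool"
  where "homomorphic_averaging_operator scale mult T \<longleftrightarrow>
    averaging_operator scale mult T \<and> (\<forall>a b. T (mult a b) = mult (T a) (T b))"

end

theory Submission
  imports Defs
begin

text \<open>For \<open>R = - T\<close>, bilinearity of the product and linearity of \<open>T\<close> turn
  \<open>R (R(a) b + a R(b) + a b)\<close> into \<open>T (T(a) b) + T (a T(b)) - T (a b)\<close>. The averaging identities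
  make each of the first two terms equal to \<open>T(a) T(b)\<close>, and multiplicativity of \<open>T\<close> does the same
  for the third. One copy survives the cancellation, and it equals \<open>R(a) R(b)\<close> because the two
  signs cancel.\<close>

theorem lemma2p4:
  fixes scale :: "'f::field_char_0 \<Rightarrow> 'a::ab_group_add \<Rightarrow> 'a"
    and mult :: "'a \<Rightarrow> 'a \<Rightarrow> 'a"
    and T :: "'a \<Rightarrow> 'a"
  assumes "field_algebra scale mult"
    and "homomorphic_averaging_operator scale mult T"
  shows "rota_baxter_operator scale mult 1 (\<lambda>a. - T a)"
proof -
  interpret field_algebra scale mult by (fact assms(1))
  interpret vector_space_pair scale scale ..
  have lin: "Vector_Spaces.linear scale scale T"
    and avg_left: "T (mult (T a) b) = mult (T a) (T b)"
    and avg_right: "T (mult a (T b)) = mult (T a) (T b)"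
    and hom: "T (mult a b) = mult (T a) (T b)" for a b
    using assms(2)
    unfolding homomorphic_averaging_operator_def averaging_operator_def by metis+
  have minus_left: "mult (- a) b = - mult a b" for a b
    using linear_neg[OF linear_mult_left] .
  have minus_right: "mult a (- b) = - mult a b" for a b
    using linear_neg[OF linear_mult_right] .
  have "Vector_Spaces.linear scale scale (\<lambda>a. - T a)"
    using lin by (rule linear_compose_neg)
  moreover have "mult (- T a) (- T b)
      = - T (mult (- T a) b + mult a (- T b) + scale 1 (mult a b))" for a b
  proof -
    have "T (mult (- T a) b + mult a (- T b) + scale 1 (mult a b))
        = - T (mult (T a) b) - T (mult a (T b)) + T (mult a b)"
      by (simp add: minus_left minus_right linear_add[OF lin] linear_diff[OF lin]
          linear_neg[OF lin])
    also have "\<dots> = - mult (T a) (T b)"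
      unfolding avg_left avg_right hom[of a b] by simp
    finally show ?thesis
      by (simp add: minus_left minus_right)
  qed
  ultimately show ?thesis
    by (simp add: rota_baxter_operator_def)
qed

end
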